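(* Every squarefree positive integer with at most $44$ prime factors is matchable.
   Context: For a positive integer $n$, let $D(n)$ be its set of positive divisors and $\tau(n)=|D(n)|$. A coprime matching between two finite sets of integers of the same cardinality is a bijection $\psi$ between them such that $\gcd(x,\psi(x))=1$ for every $x$ in the domain. A positive integer $n$ is called matchable if there is a coprime matching between $\{1,2,\dots,\tau(n)\}$ and $D(n)$. *)

theory Defs
  imports "HOL-Computational_Algebra.Computational_Algebra"
begin

definition divisors :: "nat \<Rightarrow> nat set" where
  "divisors n = {d. d dvd n}"

definition tau :: "nat \<Rightarrow> nat" where
  "tau n = card (divisors n)"

definition coprime_matching :: "(nat \<Rightarrow> nat) \<Rightarrow> nat set \<Rightarrow> nat set \<Rightarrow> bool" where
  "coprime_matching \<psi> A B \<longleftrightarrow> bij_betw \<psi> A B \<and> (\<forall>x\<in>A. gcd x (\<psi> x) = 1)"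

(* No positivity conjunct is needed: divisors 0 is all of nat and tau 0 = 0, so 0 is not matchable. *)
definition matchable :: "nat \<Rightarrow> bool" where
  "matchable n \<longleftrightarrow> (\<exists>\<psi>. coprime_matching \<psi> {1..tau n} (divisors n))"

end

theory Submission
  imports Defs
begin

text \<open>
  Let \<open>P\<close> be the set of the \<open>k\<close> primes dividing \<open>n\<close>. Passing to complementary divisors, a coprime matching
  is an injection from \<open>{1..2 ^ k}\<close> to the subsets of \<open>P\<close> that sends each \<open>x\<close> to a set containing
  all primes of \<open>P\<close> dividing \<open>x\<close>. By Hall's theorem it suffices that every upward closed family
  \<open>V\<close> of subsets of \<open>P\<close> contains the support of at most \<open>card V\<close> of these \<open>x\<close>. Revealing the primes
  of \<open>P\<close> in increasing order reduces this to a sieve inequality: among the integers up to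
  \<open>m \<le> 2 ^ 44\<close> without prime factors in a set \<open>S\<close> of primes below \<open>p\<close>, at most half are divisible by \<open>p\<close>.
  The worst case is that \<open>S\<close> consists of all primes below \<open>p\<close>. For \<open>m < p\<^sup>2\<close> it is trivial; for
  \<open>p \<le> 13\<close> a sieve with explicit error terms suffices; for \<open>p \<ge> 17\<close> the primes between \<open>p\<close> and \<open>m\<close>
  are numerous enough, by the Chebyshev bound \<open>2 ^ m \<le> Lcm {1..m} \<le> m ^ \<pi>(m)\<close>.
\<close>

section \<open>Hall's marriage theorem\<close>

text \<open>Induction on \<open>card A\<close>. A nonempty proper subset with exactly as many
  neighbours as elements splits the problem into two smaller ones. If there is no such subset, any
  admissible value for one element leaves enough room for the others.\<close>

theorem hall_marriage:
  fixes N :: "'a \<Rightarrow> 'b set"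
  assumes "finite A" "\<And>a. a \<in> A \<Longrightarrow> finite (N a)"
    and "\<And>X. X \<subseteq> A \<Longrightarrow> card X \<le> card (\<Union>(N ` X))"
  shows "\<exists>f. inj_on f A \<and> (\<forall>a\<in>A. f a \<in> N a)"
  using assms
proof (induction "card A" arbitrary: A N rule: less_induct)
  case less
  note fin = less.prems(1) and finN = less.prems(2) and hall = less.prems(3)
  show ?case
  proof (cases "\<exists>X. X \<subset> A \<and> X \<noteq> {} \<and> card X = card (\<Union>(N ` X))")
    case True
    then obtain X where X: "X \<subset> A" "X \<noteq> {}" "card X = card (\<Union>(N ` X))" by blast
    have finX: "finite X" using X(1) fin finite_subset by blast
    have cX: "card X < card A" using X(1) fin by (simp add: psubset_card_mono)
    have "\<exists>f. inj_on f X \<and> (\<forall>a\<in>X. f a \<in> N a)"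
      proof (rule less.hyps[OF cX finX])
      show "finite (N a)" if "a \<in> X" for a using that X(1) finN by blast
      show "card Y \<le> card (\<Union>(N ` Y))" if "Y \<subseteq> X" for Y using that X(1) hall by blast
    qed
    then obtain f where f: "inj_on f X" "\<forall>a\<in>X. f a \<in> N a" by blast
    let ?U = "\<Union>(N ` X)"
    let ?M = "\<lambda>a. N a - ?U"
    have "\<exists>g. inj_on g (A - X) \<and> (\<forall>a\<in>A - X. g a \<in> ?M a)"
    proof (rule less.hyps)
      show "card (A - X) < card A"
        using X fin by (intro psubset_card_mono) auto
      show "finite (A - X)" using fin by simp
      show "finite (?M a)" if "a \<in> A - X" for a using that finN by simp
      \<comment> \<open>Hall's condition for \<open>Y \<union> X\<close>, minus the equality for the
        tight set \<open>X\<close>, counts the neighbours of \<open>Y\<close> outside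
        \<open>?U\<close>.\<close>
      show "card Y \<le> card (\<Union>(?M ` Y))" if Y: "Y \<subseteq> A - X" for Y
      proof -
        have YX: "Y \<union> X \<subseteq> A" using Y X(1) by auto
        have "card Y + card X = card (Y \<union> X)"
          using Y finX fin by (intro card_Un_disjoint[symmetric]) (auto intro: finite_subset)
        also have "\<dots> \<le> card (\<Union>(N ` (Y \<union> X)))" by (rule hall[OF YX])
        also have "\<Union>(N ` (Y \<union> X)) = \<Union>(?M ` Y) \<union> ?U" by auto
        also have "card \<dots> \<le> card (\<Union>(?M ` Y)) + card ?U" by (rule card_Un_le)
        finally show ?thesis using X(3) by simp
      qed
    qed
    then obtain g where g: "inj_on g (A - X)" "\<forall>a\<in>A - X. g a \<in> ?M a" by blast
    let ?h = "\<lambda>a. if a \<in> X then f a else g a"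
    have "inj_on ?h A"
    proof (rule inj_onI)
      fix a b assume ab: "a \<in> A" "b \<in> A" "?h a = ?h b"
      have "f c \<noteq> g d" if "c \<in> X" "d \<in> A - X" for c d
        using that f(2) g(2) by force
      then show "a = b"
        using ab f(1) g(1) by (auto split: if_splits dest: inj_onD) (metis DiffI)+
    qed
    moreover have "\<forall>a\<in>A. ?h a \<in> N a" using f g by auto
    ultimately show ?thesis by blast
  next
    case False
    have slack: "card X < card (\<Union>(N ` X))" if "X \<subset> A" "X \<noteq> {}" for X
      using that hall[of X] False by (metis order_le_imp_less_or_eq psubset_imp_subset)
    show ?thesis
    proof (cases "A = {}")
      case True
      then show ?thesis by simp
    next
      case False
      then obtain a where a: "a \<in> A" by blast
      have "N a \<noteq> {}" using hall[of "{a}"] a finN[OF a] by (auto simp: card_eq_0_iff)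
      then obtain b where b: "b \<in> N a" by blast
      let ?M = "\<lambda>c. N c - {b}"
      have "\<exists>g. inj_on g (A - {a}) \<and> (\<forall>c\<in>A - {a}. g c \<in> ?M c)"
      proof (rule less.hyps)
        show "card (A - {a}) < card A" using a fin by (intro psubset_card_mono) auto
        show "finite (A - {a})" using fin by simp
        show "finite (?M c)" if "c \<in> A - {a}" for c using that finN by simp
        \<comment> \<open>Deleting \<open>b\<close> costs a neighbourhood at most one element, which
          the strict inequality \<open>slack\<close> affords.\<close>
        show "card Y \<le> card (\<Union>(?M ` Y))" if Y: "Y \<subseteq> A - {a}" for Y
        proof (cases "Y = {}")
          case False
          have "Y \<subset> A" using Y a by blast
          then have "card Y < card (\<Union>(N ` Y))" using False slack by blast
          moreover have "\<Union>(?M ` Y) = \<Union>(N ` Y) - {b}" by auto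
          moreover have "card (\<Union>(N ` Y)) - 1 \<le> card (\<Union>(N ` Y) - {b})"
            by (simp add: card_Diff_singleton_if)
          ultimately show ?thesis by simp
        qed simp
      qed
      then obtain g where g: "inj_on g (A - {a})" "\<forall>c\<in>A - {a}. g c \<in> ?M c" by blast
      have "inj_on (g(a := b)) A"
        using g by (auto simp: inj_on_def)
      moreover have "\<forall>c\<in>A. (g(a := b)) c \<in> N c" using g b by auto
      ultimately show ?thesis by blast
    qed
  qed
qed

section \<open>Sifted integers and domination of supports\<close>

definition sifted :: "nat set \<Rightarrow> nat \<Rightarrow> nat set" where
  "sifted S m = {x \<in> {1..m}. \<forall>s\<in>S. \<not> s dvd x}"

lemma finite_sifted [simp]: "finite (sifted S m)"
  by (simp add: sifted_def)

lemma sifted_empty [simp]: "sifted {} m = {1..m}"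
  by (auto simp: sifted_def)

text \<open>A prime of \<open>S\<close> differs from \<open>p\<close>, so it divides
  \<open>p * y\<close> only if it divides \<open>y\<close>. Cancelling \<open>p\<close> therefore
  turns the multiples of \<open>p\<close> into the sifted integers up to
  \<open>m div p\<close>.\<close>

lemma sifted_split:
  assumes "prime p" "\<And>s. s \<in> S \<Longrightarrow> prime s" "p \<notin> S"
  shows "sifted S m = sifted (insert p S) m \<union> (*) p ` sifted S (m div p)"
    and "sifted (insert p S) m \<inter> (*) p ` sifted S (m div p) = {}"
proof -
  have p0: "p > 0" using assms(1) by (rule prime_gt_0_nat)
  have sp: "s dvd p * y \<longleftrightarrow> s dvd y" if "s \<in> S" for s y
    using that assms by (metis dvd_mult primes_dvd_imp_eq prime_dvd_mult_iff)
  have "x \<in> (*) p ` sifted S (m div p)" if x: "x \<in> sifted S m" "p dvd x" for x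
  proof -
    obtain y where y: "x = p * y" using x(2) by blast
    then have "y \<in> sifted S (m div p)"
      using x(1) sp p0 by (auto simp: sifted_def less_eq_div_iff_mult_less_eq mult.commute Suc_le_eq)
    then show ?thesis using y by blast
  qed
  moreover have "p * y \<in> sifted S m" if "y \<in> sifted S (m div p)" for y
    using that sp p0 by (auto simp: sifted_def less_eq_div_iff_mult_less_eq mult.commute[of y] Suc_le_eq)
  ultimately show "sifted S m = sifted (insert p S) m \<union> (*) p ` sifted S (m div p)"
    by (auto simp: sifted_def)
  show "sifted (insert p S) m \<inter> (*) p ` sifted S (m div p) = {}"
    by (auto simp: sifted_def)
qed

text \<open>Legendre's recurrence for counting sifted integers.\<close>

lemma card_sifted_split:
  assumes "prime p" "\<And>s. s \<in> S \<Longrightarrow> prime s" "p \<notin> S"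
  shows "card (sifted S m) = card (sifted (insert p S) m) + card (sifted S (m div p))"
proof -
  have "inj ((*) p)" using prime_gt_0_nat[OF assms(1)] by (auto simp: inj_def)
  then have "card ((*) p ` sifted S (m div p)) = card (sifted S (m div p))"
    by (meson card_image inj_on_subset subset_UNIV)
  then show ?thesis
    using sifted_split[OF assms, of m] by (metis card_Un_disjoint finite_imageI finite_sifted)
qed

definition support :: "nat set \<Rightarrow> nat \<Rightarrow> nat set" where
  "support P x = {p \<in> P. p dvd x}"

text \<open>Chebyshev's sum inequality for two oppositely ordered pairs: the sides differ by
  \<open>(a - b) * (v1 - v0)\<close>.\<close>

lemma double_sum_mult_le:
  fixes a b v0 v1 :: nat
  assumes "b \<le> a" "v0 \<le> v1"
  shows "2 * (a * v0 + b * v1) \<le> (a + b) * (v0 + v1)"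
proof -
  obtain c d where "a = b + c" "v1 = v0 + d" using assms le_Suc_ex by blast
  then show ?thesis by (simp add: algebra_simps)
qed

text \<open>
  Uniformly chosen from \<^term>\<open>sifted S m\<close>, an integer has a support that is stochastically dominated
  by a uniformly random subset of \<^term>\<open>P\<close>. The induction splits on \<^term>\<open>Min P\<close>: its multiples
  are a rescaled \<^term>\<open>sifted S (m div Min P)\<close>, the other integers enlarge the sifting set.
\<close>

lemma support_domination:
  assumes half: "\<And>p S m. prime p \<Longrightarrow> \<forall>s\<in>S. prime s \<and> s < p \<Longrightarrow> m \<le> B \<Longrightarrow>
      2 * card (sifted S (m div p)) \<le> card (sifted S m)"
    and "finite P" "\<forall>p\<in>P. prime p" "\<forall>s\<in>S. prime s \<and> (\<forall>p\<in>P. s < p)" "m \<le> B"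
    and "V \<subseteq> Pow P" "\<And>R R'. R \<in> V \<Longrightarrow> R \<subseteq> R' \<Longrightarrow> R' \<subseteq> P \<Longrightarrow> R' \<in> V"
  shows "card {x \<in> sifted S m. support P x \<in> V} * 2 ^ card P \<le> card (sifted S m) * card V"
  using assms(2-)
proof (induction "card P" arbitrary: P S m V)
  case 0
  then have P: "P = {}" by simp
  have supp: "support P x = {}" for x by (simp add: P support_def)
  show ?case
  proof (cases "{} \<in> V")
    case True
    then have "V = {{}}" using 0 P by auto
    then show ?thesis by (simp add: supp[unfolded P] P)
  qed (simp add: supp)
next
  case (Suc j)
  note up = Suc.prems(6)
  have "P \<noteq> {}" using Suc.hyps(2) by auto
  \<comment> \<open>With the minimum, \<open>insert p S\<close> still lies below all remaining
    primes, as the induction hypothesis and \<open>half\<close> demand.\<close>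
  define p where "p = Min P"
  define P' where "P' = P - {p}"
  have p: "p \<in> P" "\<And>q. q \<in> P' \<Longrightarrow> p < q"
    using \<open>P \<noteq> {}\<close> Suc.prems(1) by (auto simp: p_def P'_def less_le)
  have P: "P = insert p P'" "p \<notin> P'" using p(1) by (auto simp: P'_def)
  have finP': "finite P'" using Suc.prems(1) by (simp add: P'_def)
  have cardP': "j = card P'" using Suc.hyps(2) P finP' by simp
  have prp: "prime p" using p Suc.prems(2) by blast
  have S: "\<And>s. s \<in> S \<Longrightarrow> prime s" "p \<notin> S" using Suc.prems(3) p by auto
  \<comment> \<open>\<open>V0\<close> and \<open>V1\<close> are the sections of \<open>V\<close>
    without and with \<open>p\<close>. Both are upward closed in \<open>P'\<close>, and upward
    closure of \<open>V\<close> gives \<open>V0 \<subseteq> V1\<close>.\<close>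
  define V0 where "V0 = {R. R \<subseteq> P' \<and> R \<in> V}"
  define V1 where "V1 = {R. R \<subseteq> P' \<and> insert p R \<in> V}"
  have sub: "V0 \<subseteq> Pow P'" "V1 \<subseteq> Pow P'" by (auto simp: V0_def V1_def)
  have fin: "finite V0" "finite V1" using sub finP' by (meson finite_Pow_iff finite_subset)+
  have "V0 \<subseteq> V1"
  proof
    fix R assume "R \<in> V0"
    then show "R \<in> V1"
      using up[of R "insert p R"] P by (auto simp: V0_def V1_def)
  qed
  then have le: "card V0 \<le> card V1" using fin by (simp add: card_mono)
  have "V = V0 \<union> insert p ` V1"
  proof
    show "V \<subseteq> V0 \<union> insert p ` V1"
    proof
      fix R assume R: "R \<in> V"
      show "R \<in> V0 \<union> insert p ` V1"
      proof (cases "p \<in> R")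
        case True
        then have "insert p (R - {p}) = R" by auto
        moreover have "R - {p} \<subseteq> P'" using R Suc.prems(5) P by auto
        ultimately have "R - {p} \<in> V1" using R by (simp add: V1_def)
        then show ?thesis using \<open>insert p (R - {p}) = R\<close> by blast
      qed (use R Suc.prems(5) P in \<open>auto simp: V0_def\<close>)
    qed
  qed (auto simp: V0_def V1_def)
  moreover have "V0 \<inter> insert p ` V1 = {}" using P by (auto simp: V0_def)
  moreover have "inj_on (insert p) V1"
    using P by (intro inj_onI) (auto simp: V1_def; blast)
  ultimately have cardV: "card V = card V0 + card V1"
    using fin by (simp add: card_Un_disjoint card_image)
  have supp0: "support P x = support P' x" if "\<not> p dvd x" for x
    using that P by (auto simp: support_def)
  have supp1: "support P (p * y) = insert p (support P' y)" for y
  proof -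
    have "q dvd p * y \<longleftrightarrow> q dvd y" if "q \<in> P'" for q
      using that Suc.prems(2) prp P by (metis dvd_mult primes_dvd_imp_eq prime_dvd_mult_iff insertCI)
    then show ?thesis using P by (auto simp: support_def)
  qed
  let ?A0 = "{x \<in> sifted (insert p S) m. support P' x \<in> V0}"
  let ?A1 = "{x \<in> sifted S (m div p). support P' x \<in> V1}"
  have "{x \<in> sifted S m. support P x \<in> V} \<subseteq> ?A0 \<union> (*) p ` ?A1"
  proof
    fix x assume x: "x \<in> {x \<in> sifted S m. support P x \<in> V}"
    then consider "x \<in> sifted (insert p S) m" | y where "y \<in> sifted S (m div p)" "x = p * y"
      using sifted_split(1)[OF prp S, of m] by blast
    then show "x \<in> ?A0 \<union> (*) p ` ?A1"
    proof cases
      case 1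
      then have "\<not> p dvd x" by (simp add: sifted_def)
      then show ?thesis using 1 x supp0 by (auto simp: V0_def support_def)
    next
      case 2
      then have "support P' y \<in> V1" using x supp1 by (auto simp: V1_def support_def)
      then show ?thesis using 2 by blast
    qed
  qed
  then have "card {x \<in> sifted S m. support P x \<in> V} \<le> card (?A0 \<union> (*) p ` ?A1)"
    by (intro card_mono) auto
  also have "\<dots> \<le> card ?A0 + card ?A1"
    by (intro order_trans[OF card_Un_le] add_mono order_refl card_image_le) auto
  finally have 1: "card {x \<in> sifted S m. support P x \<in> V} \<le> card ?A0 + card ?A1" .
  have 2: "card ?A0 * 2 ^ j \<le> card (sifted (insert p S) m) * card V0"
    unfolding cardP'
  proof (rule Suc.hyps(1))
    show "R' \<in> V0" if "R \<in> V0" "R \<subseteq> R'" "R' \<subseteq> P'" for R R'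
      using that up[of R R'] P(1) by (auto simp: V0_def)
    show "\<forall>s\<in>insert p S. prime s \<and> (\<forall>q\<in>P'. s < q)"
      using Suc.prems(3) prp p(2) P(1) by auto
  qed (use cardP' finP' Suc.prems(2,4) P(1) sub(1) in auto)
  have 3: "card ?A1 * 2 ^ j \<le> card (sifted S (m div p)) * card V1"
    unfolding cardP'
  proof (rule Suc.hyps(1))
    show "m div p \<le> B" using Suc.prems(4) div_le_dividend order_trans by blast
    show "R' \<in> V1" if "R \<in> V1" "R \<subseteq> R'" "R' \<subseteq> P'" for R R'
      using that up[of "insert p R" "insert p R'"] P(1) by (auto simp: V1_def)
  qed (use cardP' finP' Suc.prems(2,3) P(1) sub(2) in auto)
  have "2 * card (sifted S (m div p)) \<le> card (sifted S m)"
    using Suc.prems(3,4) p(1) by (intro half prp) auto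
  \<comment> \<open>Multiples of \<open>p\<close> are at most as numerous as non-multiples, while
    \<open>V1\<close> is at least as large as \<open>V0\<close>: the opposite orders that
    Chebyshev's inequality requires.\<close>
  then have "card (sifted S (m div p)) \<le> card (sifted (insert p S) m)"
    using card_sifted_split[OF prp S, of m] by simp
  note 4 = double_sum_mult_le[OF this le]
  have "card {x \<in> sifted S m. support P x \<in> V} * 2 ^ card P
      \<le> (card ?A0 + card ?A1) * 2 ^ card P" using 1 by simp
  also have "\<dots> = 2 * (card ?A0 * 2 ^ j + card ?A1 * 2 ^ j)"
    by (simp flip: Suc.hyps(2) add: algebra_simps)
  also have "\<dots> \<le> 2 * (card (sifted (insert p S) m) * card V0 + card (sifted S (m div p)) * card V1)"
    using 2 3 by simp
  also have "\<dots> \<le> (card (sifted (insert p S) m) + card (sifted S (m div p))) * (card V0 + card V1)"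
    by (rule 4)
  also have "\<dots> = card (sifted S m) * card V"
    using cardV card_sifted_split[OF prp S, of m] by simp
  finally show ?case .
qed

text \<open>Primes are dropped from \<open>T\<close> one at a time. When \<open>q\<close> is
  dropped, the inequality for \<open>S\<close> at \<open>m\<close> is the sum of those for
  \<open>insert q S\<close> at \<open>m\<close> and for \<open>S\<close> at \<open>m div q\<close>,
  hence the inner induction on \<open>m\<close>.\<close>

lemma half_sifted_antimono:
  assumes pr: "prime p" and "finite T" "\<And>q. q \<in> T \<Longrightarrow> prime q \<and> q < p" "S \<subseteq> T"
    and full: "\<And>m. m \<le> B \<Longrightarrow> 2 * card (sifted T (m div p)) \<le> card (sifted T m)"
    and "m \<le> B"
  shows "2 * card (sifted S (m div p)) \<le> card (sifted S m)"
  using \<open>S \<subseteq> T\<close> \<open>m \<le> B\<close>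
proof (induction "card (T - S)" arbitrary: S m)
  case 0
  then have "S = T" using \<open>finite T\<close> by auto
  then show ?case using full 0 by simp
next
  case (Suc j)
  then have "T - S \<noteq> {}" by auto
  then obtain q where q: "q \<in> T" "q \<notin> S" by blast
  have prq: "prime q" "\<And>s. s \<in> S \<Longrightarrow> prime s" using assms(3) q Suc.prems(1) by auto
  have "j = card (T - insert q S)"
    using Suc.hyps(2) q \<open>finite T\<close> by (simp add: card_Diff_insert)
  then have IH: "2 * card (sifted (insert q S) (m div p)) \<le> card (sifted (insert q S) m)" if "m \<le> B" for m
    using that Suc.hyps(1) q Suc.prems(1) by blast
  show ?case using \<open>m \<le> B\<close>
  proof (induction m rule: less_induct)
    case (less m)
    show ?case
    proof (cases "m = 0")
      case False
      then have "m div q < m" using prime_gt_1_nat[OF prq(1)] by simp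
      then have "2 * card (sifted S (m div q div p)) \<le> card (sifted S (m div q))"
        using less by simp
      \<comment> \<open>Divisions by \<open>p\<close> and \<open>q\<close> commute, so Legendre's
        recurrence for \<open>q\<close> splits both sides of the inequality compatibly.\<close>
      then show ?thesis
        using IH[OF less.prems] card_sifted_split[OF prq(1,2) q(2), of m]
          card_sifted_split[OF prq(1,2) q(2), of "m div p"]
        by (simp flip: div_mult2_eq add: mult.commute)
    qed (simp add: sifted_def)
  qed
qed

section \<open>A lower bound for the number of primes\<close>

text \<open>The quotients by \<open>D\<close> are entries of Leibniz's harmonic triangle scaled by
  \<open>D\<close>. They are integers for \<open>m = 1\<close>, and each later one is a difference
  of two with smaller \<open>m\<close>.\<close>

lemma binomial_dvd_common_multiple:
  fixes D N :: nat
  assumes D: "\<And>i. 1 \<le> i \<Longrightarrow> i \<le> N \<Longrightarrow> i dvd D" and "1 \<le> m" "m \<le> n" "n \<le> N"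
  shows "m * (n choose m) dvd D"
proof -
  have "real D / (real m * real (n choose m)) \<in> \<int>"
    using assms(2-)
  proof (induction m arbitrary: n rule: dec_induct)
    case base
    then have "n dvd D" using D by simp
    then show ?case using base by (auto elim!: dvdE)
  next
    case (step m)
    obtain k where k: "n = Suc k" "m \<le> k" using step.prems by (cases n) auto
    have pos: "real m > 0" "real (k choose m) > 0" "real (Suc k choose m) > 0" "real (Suc k choose Suc m) > 0"
      using step.hyps k by (auto simp del: binomial_Suc_Suc)
    have e1: "real (Suc m) * real (Suc k choose Suc m) = real (Suc k) * real (k choose m)"
      by (metis Suc_times_binomial of_nat_mult)
    have e2: "real (Suc k choose m) * (real (Suc k) - real m) = real (Suc k) * real (k choose m)"
    proof -
      have "(Suc k choose m) * (Suc k - m) = Suc k * (k choose m)"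
        using binomial_absorb_comp[of "Suc k" m] by (simp add: mult.commute)
      then have "real (Suc k choose m) * real (Suc k - m) = real (Suc k) * real (k choose m)"
        by (simp only: of_nat_mult[symmetric])
      then show ?thesis by (simp only: of_nat_diff[OF le_SucI[OF k(2)]])
    qed
    \<comment> \<open>The recurrence of Leibniz's harmonic triangle.\<close>
    have eq: "1 / (real (Suc m) * real (Suc k choose Suc m))
        = 1 / (real m * real (k choose m)) - 1 / (real m * real (Suc k choose m))"
    proof -
      have x: "real (k choose m) = real (Suc k choose m) * (real (Suc k) - real m) / real (Suc k)"
        using e2 by (simp add: field_simps)
      have pos': "real (Suc k) - real m > 0" using k by simp
      show ?thesis
        unfolding e1 unfolding x using pos(1,3) pos' by (simp add: divide_simps)
    qed
    have "real D / (real (Suc m) * real (Suc k choose Suc m))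
        = real D / (real m * real (k choose m)) - real D / (real m * real (Suc k choose m))"
      using arg_cong[OF eq, of "\<lambda>t. real D * t"] by (simp add: algebra_simps)
    moreover have "real D / (real m * real (k choose m)) \<in> \<int>"
      using step k by simp
    moreover have "real D / (real m * real (Suc k choose m)) \<in> \<int>"
      using step.IH[of "Suc k"] step.prems k by simp
    ultimately show ?case using k by simp
  qed
  then obtain z where z: "real D / (real m * real (n choose m)) = real_of_int z" by (auto elim: Ints_cases)
  have "real m * real (n choose m) \<noteq> 0" using assms by simp
  then have "real D = real_of_int z * (real m * real (n choose m))"
    using z by (rule iffD1[OF nonzero_divide_eq_eq])
  then have "int D = z * int (m * (n choose m))" by (metis of_int_eq_iff of_int_mult of_int_of_nat_eq of_nat_mult)
  then have "int (m * (n choose m)) dvd int D" by simp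
  then show ?thesis by (simp only: of_nat_dvd_iff)
qed

text \<open>Nair's argument: \<open>n * ?C\<close> and \<open>(2 * n + 1) * ?C\<close> both divide
  \<open>D\<close>, and \<open>n\<close> and \<open>2 * n + 1\<close> are coprime, so
  \<open>n * (2 * n + 1) * ?C\<close> divides \<open>D\<close>. The central binomial coefficient is
  at least \<open>4 ^ n / (2 * n)\<close>.\<close>

lemma two_power_le_common_multiple:
  fixes D m :: nat
  assumes D: "\<And>i. 1 \<le> i \<Longrightarrow> i \<le> m \<Longrightarrow> i dvd D" and "D > 0" "m \<ge> 9"
  shows "2 ^ m \<le> D"
proof -
  \<comment> \<open>So \<open>m\<close> is \<open>2 * n + 1\<close> or \<open>2 * n + 2\<close>: the
    binomials used stay within index \<open>m\<close>, and \<open>m \<ge> 9\<close> yields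
    \<open>n \<ge> 4\<close>.\<close>
  define n where "n = (m - 1) div 2"
  have n: "n \<ge> 4" "2 * n + 1 \<le> m" "m \<le> 2 * n + 2" using assms(3) by (auto simp: n_def)
  let ?C = "2 * n choose n"
  have d1: "n * ?C dvd D" using n by (intro binomial_dvd_common_multiple[OF D]) auto
  have "Suc n * (Suc (2 * n) choose Suc n) dvd D" using n by (intro binomial_dvd_common_multiple[OF D]) auto
  then have d2: "(2 * n + 1) * ?C dvd D" by (metis Suc_times_binomial Suc_eq_plus1)
  obtain E where E: "D = ?C * E" using d1 by (metis dvd_def dvd_mult_right)
  have C0: "?C > 0" by simp
  have "n dvd E" "2 * n + 1 dvd E"
    using d1 d2 C0 unfolding E by (simp_all only: mult.commute[of _ ?C] nat_mult_dvd_cancel1)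
  moreover have "coprime n (2 * n + 1)"
    by (metis coprime_add_one_right coprime_mult_left_iff)
  ultimately have "n * (2 * n + 1) dvd E" by (rule divides_mult)
  then have "n * (2 * n + 1) \<le> E" using E \<open>D > 0\<close> by (auto intro: dvd_imp_le)
  then have "?C * (n * (2 * n + 1)) \<le> D" using E by simp
  then have 1: "real ?C * (real n * (2 * real n + 1)) \<le> real D"
    by (metis (mono_tags, opaque_lifting) of_nat_1 of_nat_add of_nat_le_iff of_nat_mult of_nat_numeral)
  have "4 ^ n / (2 * real n) \<le> real ?C" using n by (intro central_binomial_lower_bound) auto
  then have "4 ^ n / (2 * real n) * (real n * (2 * real n + 1)) \<le> real ?C * (real n * (2 * real n + 1))"
    by (intro mult_right_mono) auto
  moreover have "4 ^ n / (2 * real n) * (real n * (2 * real n + 1)) = 4 ^ n * (2 * real n + 1) / 2"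
    using n by (simp add: field_simps)
  ultimately have "4 ^ n * (2 * real n + 1) / 2 \<le> real D" using 1 by linarith
  \<comment> \<open>The factor 8, halved, lifts \<open>4 ^ n\<close> to
    \<open>2 ^ (2 * n + 2)\<close>, which covers the even case \<open>m = 2 * n + 2\<close>.\<close>
  moreover have "4 ^ n * 8 \<le> 4 ^ n * (2 * real n + 1)" using n by (intro mult_left_mono) auto
  ultimately have "4 ^ n * 4 \<le> real D" by linarith
  then have "real (2 ^ (2 * n + 2)) \<le> real D" by (simp add: power_add power_mult)
  then have "2 ^ (2 * n + 2) \<le> D" by (simp only: of_nat_le_iff)
  moreover have "(2::nat) ^ m \<le> 2 ^ (2 * n + 2)" using n by (intro power_increasing) auto
  ultimately show ?thesis by linarith
qed

text \<open>Each prime up to \<open>m\<close> contributes to the \<open>Lcm\<close> its largest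
  power not exceeding \<open>m\<close>, a factor of at most \<open>m\<close>.\<close>

lemma Lcm_le_power_card_primes:
  assumes "m \<ge> 1"
  shows "Lcm {1..m} \<le> m ^ card {p :: nat. prime p \<and> p \<le> m}"
proof -
  let ?L = "Lcm {1..m}" and ?P = "{p :: nat. prime p \<and> p \<le> m}"
  have finP: "finite ?P" by (rule finite_subset[of _ "{..m}"]) auto
  have "\<exists>k. p ^ k \<le> m \<and> m < p ^ Suc k" if "p \<in> ?P" for p
    using that ex_power_ivl1[of p m] prime_ge_2_nat[of p] assms by auto
  then have "\<forall>p\<in>?P. \<exists>k. p ^ k \<le> m \<and> m < p ^ Suc k" by blast
  then obtain e where "\<forall>p\<in>?P. p ^ e p \<le> m \<and> m < p ^ Suc (e p)" by (rule bchoice[THEN exE])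
  then have e: "p ^ e p \<le> m \<and> m < p ^ Suc (e p)" if "p \<in> ?P" for p using that by (rule bspec)
  let ?D = "\<Prod>p\<in>?P. p ^ e p"
  have D0: "?D \<noteq> 0" using finP by (auto simp: prime_gt_0_nat)
  have "?L dvd ?D"
  proof (rule Lcm_least)
    fix x assume x: "x \<in> {1..m}"
    show "x dvd ?D"
    proof (rule multiplicity_le_imp_dvd)
      fix p :: nat assume p: "prime p"
      show "multiplicity p x \<le> multiplicity p ?D"
      proof (cases "p dvd x")
        case True
        then have "p \<le> m" using x by (auto dest!: dvd_imp_le)
        then have pP: "p \<in> ?P" using p by simp
        have "p ^ multiplicity p x \<le> x" using x by (intro dvd_imp_le multiplicity_dvd) auto
        then have "p ^ multiplicity p x < p ^ Suc (e p)" using x e[OF pP] by auto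
        then have "multiplicity p x < Suc (e p)" by (rule power_less_imp_less_exp[OF prime_gt_1_nat[OF p]])
        moreover have "p ^ e p dvd ?D" using finP pP by (intro dvd_prodI)
        then have "e p \<le> multiplicity p ?D" using D0 p by (intro multiplicity_geI) (auto dest: not_prime_unit)
        ultimately show ?thesis by simp
      qed (simp add: not_dvd_imp_multiplicity_0)
    qed (use x in auto)
  qed
  then have "?L \<le> ?D" using D0 by (intro dvd_imp_le) (simp_all only: neq0_conv)
  also have "\<dots> \<le> (\<Prod>p\<in>?P. m)" using e by (intro prod_mono) auto
  finally show ?thesis by simp
qed

text \<open>The exponents of 2 are compared in \<open>2 ^ m \<le> m ^ ?c \<le> 2 ^ (l * ?c)\<close>;
  the natural number \<open>l\<close> stands in for the binary logarithm of
  \<open>m\<close>.\<close>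

lemma card_primes_lower_bound:
  assumes "m \<ge> 9" "m \<le> 2 ^ l"
  shows "m \<le> l * card {p :: nat. prime p \<and> p \<le> m}"
proof -
  let ?c = "card {p :: nat. prime p \<and> p \<le> m}"
  have "2 ^ m \<le> Lcm {1..m}"
    using assms Lcm_0_iff[of "{1..m}"] by (intro two_power_le_common_multiple) (auto intro: dvd_Lcm simp: neq0_conv[symmetric] simp del: neq0_conv)
  also have "\<dots> \<le> m ^ ?c" using assms by (intro Lcm_le_power_card_primes) auto
  also have "\<dots> \<le> (2 ^ l) ^ ?c" using assms by (intro power_mono) auto
  finally have "(2::nat) ^ m \<le> 2 ^ (l * ?c)" by (simp add: power_mult)
  then show ?thesis by simp
qed

section \<open>The sieve inequality\<close>

abbreviation primes_below :: "nat \<Rightarrow> nat set" where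
  "primes_below p \<equiv> {q. prime q \<and> q < p}"

lemma sifted_primes_below_small:
  assumes "1 \<le> m" "m < p"
  shows "sifted (primes_below p) m = {1}"
proof
  show "sifted (primes_below p) m \<subseteq> {1}"
  proof
    fix x assume x: "x \<in> sifted (primes_below p) m"
    have "\<not> (prime q \<and> q dvd x)" for q
    proof
      assume q: "prime q \<and> q dvd x"
      then have "q \<le> x" using x by (auto simp: sifted_def dest: dvd_imp_le)
      then show False using q x assms by (auto simp: sifted_def)
    qed
    then show "x \<in> {1}" using prime_factor_nat[of x] by auto
  qed
qed (use assms in \<open>auto simp: sifted_def\<close>)

text \<open>For \<open>m < p\<close> nothing is counted on the left. Otherwise
  \<open>m div p < p\<close> leaves only 1 there, while 1 and \<open>p\<close> survive on the
  right.\<close>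

lemma half_sifted_below_square:
  assumes "prime p" "m < p\<^sup>2"
  shows "2 * card (sifted (primes_below p) (m div p)) \<le> card (sifted (primes_below p) m)"
proof (cases "m < p")
  case False
  have p1: "p > 1" using assms(1) by (rule prime_gt_1_nat)
  then have "m div p < p" "1 \<le> m div p"
    using assms False by (simp_all add: less_mult_imp_div_less power2_eq_square Suc_le_eq div_greater_zero_iff)
  then have 1: "card (sifted (primes_below p) (m div p)) = 1"
    by (simp add: sifted_primes_below_small)
  have "{1, p} \<subseteq> sifted (primes_below p) m"
    using False p1 assms(1) by (auto simp: sifted_def dest: primes_dvd_imp_eq)
  then have "card {1, p} \<le> card (sifted (primes_below p) m)" by (intro card_mono) auto
  then show ?thesis using 1 p1 by simp
qed (simp add: sifted_def)

text \<open>The \<open>m + 1\<close> in the lower bound absorbs the rounding in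
  \<open>m div p\<close>, so that sifting by one more prime merely doubles \<open>c\<close>.\<close>

definition density_bound :: "nat set \<Rightarrow> real \<Rightarrow> real \<Rightarrow> bool" where
  "density_bound S \<delta> c \<longleftrightarrow> (\<forall>m. \<delta> * (real m + 1) - c \<le> real (card (sifted S m)) \<and>
     real (card (sifted S m)) \<le> \<delta> * real m + c)"

lemma density_bound_two: "density_bound {2} (1/2) (1/2)"
  unfolding density_bound_def
proof
  fix m :: nat
  have "m = card (sifted {2} m) + m div 2" using card_sifted_split[of 2 "{}" m] by simp
  then have "m \<le> 2 * card (sifted {2} m)" "2 * card (sifted {2} m) \<le> m + 1" by linarith+
  then have "real m \<le> 2 * real (card (sifted {2} m))" "2 * real (card (sifted {2} m)) \<le> real m + 1"
    by linarith+
  then show "1/2 * (real m + 1) - 1/2 \<le> real (card (sifted {2} m)) \<and>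
      real (card (sifted {2} m)) \<le> 1/2 * real m + 1/2" by (simp add: field_simps)
qed

text \<open>In Legendre's recurrence the errors of the two counts add up, and \<open>m div p\<close>
  lies between \<open>m / p - 1\<close> and \<open>m / p\<close>.\<close>

lemma density_bound_insert:
  assumes "density_bound S \<delta> c" "\<delta> \<ge> 0" "prime p" "\<forall>s\<in>S. prime s" "p \<notin> S"
  shows "density_bound (insert p S) (\<delta> * (1 - 1 / real p)) (2 * c)"
  unfolding density_bound_def
proof
  fix m :: nat
  have p0: "p > 0" using assms(3) by (rule prime_gt_0_nat)
  have eq: "real (card (sifted S m)) = real (card (sifted (insert p S) m)) + real (card (sifted S (m div p)))"
    using card_sifted_split[of p S m] assms(3-5) by simp
  have m: "\<delta> * (real m + 1) - c \<le> real (card (sifted S m))" "real (card (sifted S m)) \<le> \<delta> * real m + c"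
    and d: "\<delta> * (real (m div p) + 1) - c \<le> real (card (sifted S (m div p)))"
      "real (card (sifted S (m div p))) \<le> \<delta> * real (m div p) + c"
    using assms(1) unfolding density_bound_def by blast+
  have "m < p * (m div p + 1)" using dividend_less_times_div[OF p0, of m] by simp
  then have "real m < real p * (real (m div p) + 1)"
    by (metis of_nat_1 of_nat_add of_nat_less_iff of_nat_mult)
  then have "real m / real p \<le> real (m div p) + 1" using p0 by (simp add: field_simps)
  then have lo: "\<delta> * (real m / real p) \<le> \<delta> * (real (m div p) + 1)" using assms(2) by (rule mult_left_mono)
  have "real (m div p) \<le> real m / real p" by (rule of_nat_div_le_of_nat)
  also have "\<dots> \<le> (real m + 1) / real p" using p0 by (simp add: divide_right_mono)
  finally have hi: "\<delta> * real (m div p) \<le> \<delta> * ((real m + 1) / real p)" using assms(2) by (rule mult_left_mono)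
  have "\<delta> * (1 - 1 / real p) * (real m + 1) = \<delta> * (real m + 1) - \<delta> * ((real m + 1) / real p)"
    "\<delta> * (1 - 1 / real p) * real m = \<delta> * real m - \<delta> * (real m / real p)"
    by (simp_all add: algebra_simps)
  then show "\<delta> * (1 - 1 / real p) * (real m + 1) - 2 * c \<le> real (card (sifted (insert p S) m)) \<and>
      real (card (sifted (insert p S) m)) \<le> \<delta> * (1 - 1 / real p) * real m + 2 * c"
    using eq m d lo hi by linarith
qed

text \<open>The main terms leave \<open>\<delta> * (m + 1 - 2 * m / p)\<close>, which for
  \<open>p \<ge> 2\<close> is smallest at \<open>m = p\<^sup>2\<close>, where it equals
  \<open>\<delta> * (p - 1)\<^sup>2\<close>. The errors total \<open>c\<close> from the right side
  and \<open>2 * c\<close> from the doubled left side.\<close>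

lemma half_of_density_bound:
  assumes "density_bound S \<delta> c" "\<delta> \<ge> 0" "p \<ge> 2" "p\<^sup>2 \<le> m" "3 * c \<le> \<delta> * (real p - 1)\<^sup>2"
  shows "2 * card (sifted S (m div p)) \<le> card (sifted S m)"
proof -
  have m: "\<delta> * (real m + 1) - c \<le> real (card (sifted S m))"
    and d: "real (card (sifted S (m div p))) \<le> \<delta> * real (m div p) + c"
    using assms(1) unfolding density_bound_def by blast+
  have p: "real p \<ge> 2" using assms(3) by simp
  have "real (m div p) \<le> real m / real p" by (rule of_nat_div_le_of_nat)
  have m2: "(real p)\<^sup>2 \<le> real m" using assms(4) by (metis of_nat_le_iff of_nat_power)
  have "(real p - 1)\<^sup>2 = (real p)\<^sup>2 * (1 - 2 / real p) + 1"
    using p by (simp add: field_simps power2_eq_square)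
  also have "\<dots> \<le> real m * (1 - 2 / real p) + 1"
    using m2 p by (intro add_mono mult_right_mono) (auto simp: field_simps)
  also have "\<dots> = real m + 1 - 2 * (real m / real p)" by (simp add: algebra_simps)
  also have "\<dots> \<le> real m + 1 - 2 * real (m div p)"
    using \<open>real (m div p) \<le> real m / real p\<close> by linarith
  finally have "\<delta> * (real p - 1)\<^sup>2 \<le> \<delta> * (real m + 1 - 2 * real (m div p))"
    using assms(2) by (rule mult_left_mono)
  also have "\<dots> = \<delta> * (real m + 1) - 2 * (\<delta> * real (m div p))" by (simp add: algebra_simps)
  finally have "3 * c \<le> \<delta> * (real m + 1) - 2 * (\<delta> * real (m div p))" using assms(5) by linarith
  then have "2 * real (card (sifted S (m div p))) \<le> real (card (sifted S m))" using m d by linarith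
  then show ?thesis by linarith
qed

text \<open>Here and in the next three lemmas the density is the product of \<open>1 - 1 / q\<close>
  over the sifting primes \<open>q\<close>, and the error doubles each time.\<close>

lemma density_bound_3: "density_bound {3, 2} (1/3) 1"
  using density_bound_insert[OF density_bound_two, of 3] by auto

lemma density_bound_5: "density_bound {5, 3, 2} (4/15) 2"
  using density_bound_insert[OF density_bound_3, of 5] by auto

lemma density_bound_7: "density_bound {7, 5, 3, 2} (8/35) 4"
  using density_bound_insert[OF density_bound_5, of 7] by auto

lemma density_bound_11: "density_bound {11, 7, 5, 3, 2} (16/77) 8"
  using density_bound_insert[OF density_bound_7, of 11] by auto

lemma primes_below_values:
  "primes_below 2 = {}" "primes_below 3 = {2}" "primes_below 5 = {3, 2}" "primes_below 7 = {5, 3, 2}"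
  "primes_below 11 = {7, 5, 3, 2}" "primes_below 13 = {11, 7, 5, 3, 2}"
  "primes_below 17 = {13, 11, 7, 5, 3, 2}"
proof -
  have *: "q \<in> {2, 3, 5, 7, 11, 13}" if "prime q" "q < 17" for q :: nat
  proof -
    have "q \<in> {..<17}" using that(2) by simp
    then show ?thesis using that(1) by (auto simp: lessThan_nat_numeral)
  qed
  have **: "primes_below n = {q \<in> {2, 3, 5, 7, 11, 13}. q < n}" if "n \<le> 17" for n :: nat
  proof (intro set_eqI iffI)
    fix q assume "q \<in> primes_below n"
    then show "q \<in> {q \<in> {2, 3, 5, 7, 11, 13}. q < n}" using *[of q] that by simp
  next
    fix q assume "q \<in> {q \<in> {2, 3, 5, 7, 11, 13 :: nat}. q < n}"
    then show "q \<in> primes_below n" by auto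
  qed
  show "primes_below 2 = {}" "primes_below 3 = {2}" "primes_below 5 = {3, 2}" "primes_below 7 = {5, 3, 2}"
    "primes_below 11 = {7, 5, 3, 2}" "primes_below 13 = {11, 7, 5, 3, 2}"
    "primes_below 17 = {13, 11, 7, 5, 3, 2}"
    by (subst **; auto)+
qed

text \<open>For \<open>p = 2\<close> nothing is sifted. For the others
  \<open>3 * c \<le> \<delta> * (p - 1)\<^sup>2\<close> is a numerical check, tightest at
  \<open>p = 13\<close>, where it reads \<open>24 \<le> 16/77 * 144\<close>.\<close>

lemma half_sifted_small_prime:
  assumes "prime p" "p < 17" "p\<^sup>2 \<le> m"
  shows "2 * card (sifted (primes_below p) (m div p)) \<le> card (sifted (primes_below p) m)"
proof -
  have "p \<in> {13, 11, 7, 5, 3, 2}"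
    using primes_below_values(7) assms(1,2) by auto
  then consider "p = 2" | "p = 3" | "p = 5" | "p = 7" | "p = 11" | "p = 13" by auto
  then show ?thesis
  proof cases
    case 1
    then show ?thesis by (simp add: primes_below_values)
  next
    case 2
    show ?thesis unfolding 2 primes_below_values
      using assms(3) 2 by (intro half_of_density_bound[OF density_bound_two]) (simp_all add: power2_eq_square)
  next
    case 3
    show ?thesis unfolding 3 primes_below_values
      using assms(3) 3 by (intro half_of_density_bound[OF density_bound_3]) (simp_all add: power2_eq_square)
  next
    case 4
    show ?thesis unfolding 4 primes_below_values
      using assms(3) 4 by (intro half_of_density_bound[OF density_bound_5]) (simp_all add: power2_eq_square)
  next
    case 5
    show ?thesis unfolding 5 primes_below_values
      using assms(3) 5 by (intro half_of_density_bound[OF density_bound_7]) (simp_all add: power2_eq_square)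
  next
    case 6
    show ?thesis unfolding 6 primes_below_values
      using assms(3) 6 by (intro half_of_density_bound[OF density_bound_11]) (simp_all add: power2_eq_square)
  qed
qed

text \<open>It is enough to compare multiples with non-multiples of \<open>p\<close>. The former
  number at most \<open>m / 51 + 1 - card Q\<close>, the latter at least
  \<open>card Pm - card Q - 2\<close>. The unknown \<open>card Q\<close> cancels, leaving
  \<open>m / 51 + 3 \<le> card Pm\<close>.\<close>

lemma half_sifted_large_prime:
  assumes "prime p" "p \<ge> 17" "p\<^sup>2 \<le> m" "m \<le> 2 ^ 44"
  shows "2 * card (sifted (primes_below p) (m div p)) \<le> card (sifted (primes_below p) m)"
proof -
  let ?S = "primes_below p"
  define Q where "Q = {q. prime q \<and> 5 \<le> q \<and> q < p}"
  define Pm where "Pm = {q. prime q \<and> q \<le> m}"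
  have finQ: "finite Q" by (rule finite_subset[of _ "{..p}"]) (auto simp: Q_def)
  have finPm: "finite Pm" by (rule finite_subset[of _ "{..m}"]) (auto simp: Pm_def)
  have pX: "p \<le> m div p"
    using assms(2,3) by (simp add: less_eq_div_iff_mult_less_eq power2_eq_square)
  have "289 \<le> p\<^sup>2" using power_mono[OF assms(2), of 2] by simp
  then have m289: "289 \<le> m" using assms(3) by linarith
  \<comment> \<open>The primes in \<open>Q\<close> are coprime to 6 and at most
    \<open>m div p\<close>, but are sifted out by \<open>?S\<close>, so they count in addition. The
    density \<open>1/3\<close> and \<open>p \<ge> 17\<close> yield the 51.\<close>
  have "sifted ?S (m div p) \<union> Q \<subseteq> sifted {3, 2} (m div p)"
  proof
    fix x assume "x \<in> sifted ?S (m div p) \<union> Q"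
    then show "x \<in> sifted {3, 2} (m div p)"
    proof
      assume "x \<in> sifted ?S (m div p)"
      then show ?thesis using assms(2) by (auto simp: sifted_def)
    next
      assume x: "x \<in> Q"
      then have "\<not> 2 dvd x" "\<not> 3 dvd x"
        using primes_dvd_imp_eq[of 2 x] primes_dvd_imp_eq[of 3 x] by (auto simp: Q_def)
      then show ?thesis using x pX by (auto simp: sifted_def Q_def)
    qed
  qed
  then have "card (sifted ?S (m div p) \<union> Q) \<le> card (sifted {3, 2} (m div p))"
    by (intro card_mono) auto
  moreover have "sifted ?S (m div p) \<inter> Q = {}" by (auto simp: sifted_def Q_def)
  ultimately have "card (sifted ?S (m div p)) + card Q \<le> card (sifted {3, 2} (m div p))"
    using finQ by (simp add: card_Un_disjoint)
  moreover have "real (card (sifted {3, 2} (m div p))) \<le> real (m div p) / 3 + 1"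
    using density_bound_3 by (simp add: density_bound_def)
  moreover have "real (m div p) \<le> real m / real p" by (rule of_nat_div_le_of_nat)
  moreover have "real m / real p \<le> real m / 17" using assms(2) by (intro divide_left_mono) auto
  ultimately have upper: "real (card (sifted ?S (m div p))) + real (card Q) \<le> real m / 51 + 1"
    by linarith
  \<comment> \<open>What remains of \<open>Pm\<close> are the primes above \<open>p\<close>. The
    survivor 1 is counted separately and reduces the loss from 3 to 2.\<close>
  have "Pm - insert 2 (insert 3 (insert p Q)) \<subseteq> sifted (insert p ?S) m - {1}"
  proof
    fix x assume x: "x \<in> Pm - insert 2 (insert 3 (insert p Q))"
    then have prx: "prime x" "x \<le> m" by (auto simp: Pm_def)
    have "x \<noteq> 4" using prx(1) by auto
    then have "x < 5 \<Longrightarrow> False" using x prime_ge_2_nat[OF prx(1)] by auto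
    then have "p < x" using x prx by (force simp: Q_def)
    then have "\<not> q dvd x" if "q \<in> insert p ?S" for q
      using that primes_dvd_imp_eq[of q x] prx(1) assms(1) by auto
    then show "x \<in> sifted (insert p ?S) m - {1}"
      using prx prime_gt_1_nat[OF prx(1)] by (auto simp: sifted_def)
  qed
  then have "card (Pm - insert 2 (insert 3 (insert p Q))) \<le> card (sifted (insert p ?S) m - {1})"
    by (intro card_mono) auto
  moreover have "1 \<in> sifted (insert p ?S) m"
    using m289 assms(1) by (auto simp: sifted_def)
  ultimately have "card (Pm - insert 2 (insert 3 (insert p Q))) + 1 \<le> card (sifted (insert p ?S) m)"
    using card_Suc_Diff1[of "sifted (insert p ?S) m" 1] by simp
  moreover have "card Pm - card (insert 2 (insert 3 (insert p Q))) \<le> card (Pm - insert 2 (insert 3 (insert p Q)))"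
    using finQ by (intro diff_card_le_card_Diff) auto
  moreover have "card (insert 2 (insert 3 (insert p Q))) \<le> 3 + card Q"
    using finQ by (simp add: card_insert_if)
  ultimately have lower: "card Pm \<le> card (sifted (insert p ?S) m) + 2 + card Q" by linarith
  \<comment> \<open>The bound \<open>m \<le> 2 ^ 44\<close> enters only here: it leaves \<open>1/44 > 1/51\<close>.\<close>
  have "real m / 51 + 3 \<le> real (card Pm)"
  \<comment> \<open>Above 1024 the gap \<open>m / 44 - m / 51\<close> exceeds the additive 3. Up to
    \<open>2 ^ 10\<close> the stronger bound \<open>m / 10\<close> holds, and
    \<open>m \<ge> 289\<close> makes it sufficient.\<close>
  proof (cases "m \<le> 1024")
    case True
    then have "m \<le> 10 * card Pm" unfolding Pm_def using m289 by (intro card_primes_lower_bound) auto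
    then show ?thesis using m289 by linarith
  next
    case False
    then have "m \<le> 44 * card Pm" unfolding Pm_def using assms(4) by (intro card_primes_lower_bound) auto
    then show ?thesis using False by linarith
  qed
  then have "card (sifted ?S (m div p)) \<le> card (sifted (insert p ?S) m)" using upper lower by linarith
  then show ?thesis using card_sifted_split[OF assms(1), of ?S m] by simp
qed

lemma half_sifted:
  assumes "prime p" "\<forall>s\<in>S. prime s \<and> s < p" "m \<le> 2 ^ 44"
  shows "2 * card (sifted S (m div p)) \<le> card (sifted S m)"
proof (rule half_sifted_antimono[where T = "primes_below p" and B = "2 ^ 44"])
  show "2 * card (sifted (primes_below p) (m div p)) \<le> card (sifted (primes_below p) m)"
    if "m \<le> 2 ^ 44" for m
    using that assms(1) half_sifted_below_square half_sifted_small_prime half_sifted_large_prime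
    by (meson not_le)
qed (use assms in auto)

section \<open>The matching\<close>

lemma prime_factors_prod_primes:
  fixes R :: "nat set"
  assumes "finite R" "\<And>p. p \<in> R \<Longrightarrow> prime p"
  shows "prime_factors (\<Prod>R) = R"
proof -
  have "0 \<notin> R" using assms(2) not_prime_0 by blast
  then have "prime_factors (\<Prod>p\<in>R. p) = \<Union>((prime_factors \<circ> (\<lambda>p. p)) ` R)"
    using assms(1) by (intro prime_factors_prod) auto
  then show ?thesis using assms by (auto simp: prime_prime_factors)
qed

text \<open>Divisors of a squarefree number are squarefree, hence products of their distinct prime
  factors; the inverse map is \<open>prime_factors\<close>.\<close>

lemma bij_betw_prod_divisors:
  assumes "n > 0" "squarefree n"
  shows "bij_betw \<Prod> (Pow (prime_factors n)) (divisors n)"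
proof (rule bij_betw_byWitness[where f' = prime_factors])
  have n: "n \<noteq> 0" using assms(1) by simp
  have prod: "\<Prod>(prime_factors d) = d" if "d dvd n" for d
  proof -
    have "squarefree d" using that assms(2) squarefree_mono by blast
    moreover have d0: "d \<noteq> 0" using that n by auto
    ultimately have "multiplicity p d = 1" if "p \<in> prime_factors d" for p
      using that by (auto simp: squarefree_factorial_semiring'' prime_factors_multiplicity le_Suc_eq)
    then have "(\<Prod>p\<in>prime_factors d. p ^ multiplicity p d) = \<Prod>(prime_factors d)"
      by (intro prod.cong) auto
    then show ?thesis using prime_factorization_nat[of d] d0 by simp
  qed
  have fin: "finite R" "\<And>p. p \<in> R \<Longrightarrow> prime p" if "R \<subseteq> prime_factors n" for R
    using that by (auto intro: finite_subset)
  show "\<forall>R\<in>Pow (prime_factors n). prime_factors (\<Prod>R) = R"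
    using fin by (auto simp: prime_factors_prod_primes simp del: in_prime_factors_iff)
  show "\<forall>d\<in>divisors n. \<Prod>(prime_factors d) = d"
    by (simp add: divisors_def prod)
  show "\<Prod> ` Pow (prime_factors n) \<subseteq> divisors n"
  proof (clarsimp simp: divisors_def simp del: in_prime_factors_iff)
    fix R assume "R \<subseteq> prime_factors n"
    then have "\<Prod>R dvd \<Prod>(prime_factors n)" by (intro prod_dvd_prod_subset) auto
    then show "\<Prod>R dvd n" by (simp add: prod)
  qed
  show "prime_factors ` divisors n \<subseteq> Pow (prime_factors n)"
    using dvd_prime_factors[OF n] by (auto simp: divisors_def simp del: in_prime_factors_iff)
qed

theorem theorem4p1:
  fixes n :: nat
  assumes "n > 0"
    and "squarefree n"
    and "card (prime_factors n) \<le> 44"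
  shows "matchable n"
proof -
  let ?P = "prime_factors n"
  let ?A = "{1..tau n}"
  have bij: "bij_betw \<Prod> (Pow ?P) (divisors n)" by (rule bij_betw_prod_divisors[OF assms(1,2)])
  then have tau: "tau n = 2 ^ card ?P"
    by (simp add: tau_def card_Pow flip: bij_betw_same_card)
  have "(2::nat) ^ card ?P \<le> 2 ^ 44" using assms(3) by (intro power_increasing) auto
  then have tau_le: "tau n \<le> 2 ^ 44" by (simp add: tau)
  have "\<exists>f. inj_on f ?A \<and> (\<forall>x\<in>?A. f x \<in> {R. R \<subseteq> ?P \<and> support ?P x \<subseteq> R})"
  proof (rule hall_marriage)
    show "finite {R. R \<subseteq> ?P \<and> support ?P x \<subseteq> R}" for x by simp
    show "card X \<le> card (\<Union>x\<in>X. {R. R \<subseteq> ?P \<and> support ?P x \<subseteq> R})" if X: "X \<subseteq> ?A" for X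
    proof -
      \<comment> \<open>The neighbourhood of \<open>X\<close> is the upward closed family generated
        by the supports of its elements. Domination with nothing sifted out applies at
        \<open>tau n = 2 ^ card ?P\<close>, where the powers of 2 cancel.\<close>
      let ?V = "\<Union>x\<in>X. {R. R \<subseteq> ?P \<and> support ?P x \<subseteq> R}"
      have "card {x \<in> sifted {} (tau n). support ?P x \<in> ?V} * 2 ^ card ?P
          \<le> card (sifted {} (tau n)) * card ?V"
      proof (rule support_domination[where B = "2 ^ 44"])
        show "?V \<subseteq> Pow ?P" by blast
        show "R' \<in> ?V" if "R \<in> ?V" "R \<subseteq> R'" "R' \<subseteq> ?P" for R R' using that by blast
      qed (use tau_le half_sifted in auto)
      moreover have "sifted {} (tau n) = ?A" by (auto simp: sifted_def)
      ultimately have "card {x \<in> ?A. support ?P x \<in> ?V} \<le> card ?V" by (simp add: tau)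
      moreover have "X \<subseteq> {x \<in> ?A. support ?P x \<in> ?V}" using X by (auto simp: support_def)
      then have "card X \<le> card {x \<in> ?A. support ?P x \<in> ?V}" by (intro card_mono) auto
      ultimately show ?thesis by linarith
    qed
  qed simp
  then obtain f where f: "inj_on f ?A" "\<And>x. x \<in> ?A \<Longrightarrow> f x \<subseteq> ?P" "\<And>x. x \<in> ?A \<Longrightarrow> support ?P x \<subseteq> f x"
    by blast
  \<comment> \<open>Since \<open>f x\<close> contains every prime of \<open>?P\<close> dividing
    \<open>x\<close>, the complementary product is coprime to \<open>x\<close>.\<close>
  define \<psi> where "\<psi> x = \<Prod>(?P - f x)" for x
  have div: "\<psi> x \<in> divisors n" for x
    using bij by (auto simp: \<psi>_def bij_betw_def)
  have "inj_on \<psi> ?A"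
  proof (rule inj_onI)
    fix x y assume xy: "x \<in> ?A" "y \<in> ?A" "\<psi> x = \<psi> y"
    have "?P - f x = ?P - f y"
      using bij xy(3) unfolding \<psi>_def bij_betw_def by (auto dest!: inj_onD)
    then have "f x = f y" using f(2)[OF xy(1)] f(2)[OF xy(2)] by blast
    then show "x = y" using f(1) xy by (auto dest: inj_onD)
  qed
  \<comment> \<open>Surjectivity follows from injectivity by counting: both sets have
    \<open>tau n\<close> elements.\<close>
  moreover have "\<psi> ` ?A = divisors n"
  proof (rule card_subset_eq)
    show "finite (divisors n)" using assms(1) by (simp add: divisors_def)
    show "card (\<psi> ` ?A) = card (divisors n)"
      using \<open>inj_on \<psi> ?A\<close> by (simp add: card_image tau_def)
  qed (use div in blast)
  moreover have "gcd x (\<psi> x) = 1" if "x \<in> ?A" for x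
  proof -
    have "coprime x p" if "p \<in> ?P - f x" for p
    proof -
      have "\<not> p dvd x" using that f(3)[OF \<open>x \<in> ?A\<close>] by (auto simp: support_def)
      then show ?thesis using that by (metis DiffD1 coprime_commute in_prime_factors_imp_prime prime_imp_coprime)
    qed
    then have "coprime x (\<psi> x)" unfolding \<psi>_def by (intro prod_coprime_right)
    then show ?thesis by simp
  qed
  ultimately show ?thesis
    unfolding matchable_def coprime_matching_def bij_betw_def by blast
qed

end
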